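(* Let $N\ge 2$, $n\ge 1$, let $\mathbf{A}=[a_{ij}]\in\mathbb{R}^{N\times N}$ be a row-stochastic matrix with non-negative entries and zero diagonal, and let $\mathcal{N}_i=\{j: a_{ij}>0\}$. Assume: (1) the target displacements $\zeta_{ji}^*\in\mathbb{R}^n$ ($j\in\mathcal{N}_i$) are geometrically realizable, i.e. there are $\mathbf{x}_1^*,\dots,\mathbf{x}_N^*\in\mathbb{R}^n$ with $\zeta_{ji}^*=\mathbf{x}_j^*-\mathbf{x}_i^*$; (2) the directed graph $\mathcal{G}$ of $\mathbf{A}$ contains a rooted spanning tree, i.e. there is a node $k\in[N]$ from which every other node can be reached along directed paths of information flow (with information flowing from $j$ to $i$ whenever $a_{ij}>0$). Let $k_p>0$, $\eta_w>0$, $\gamma\in(0,1]$, $\epsilon\in(0,1)$. Consider $N$ robots whose states $\mathbf{y}_i(t)=\mathbf{x}_i(t)-\mathbf{x}_i^*\in\mathbb{R}^n$ evolve for $t\ge 0$ under $$\dot{\mathbf{y}}_i(t) = k_p \sum_{j=1}^{N} w_{ij}(t)\,(\mathbf{y}_j(t)-\mathbf{y}_i(t)),\qquad i\in[N],$$ where the weights $w_{ij}(t)$ are updated by the Online Exponential Gradient Flow (OExpGF) algorithm (defined in the context) with parameters $\eta_w,\gamma,\epsilon$. Then, for any initial condition $\mathbf{y}(0)=[\mathbf{y}_1(0)^{T}\cdots\mathbf{y}_N(0)^{T}]^{T}\in\mathbb{R}^{Nn}$, asymptotic consensus is achieved: $$\lim_{t\to\infty}\|\mathbf{y}_i(t)-\mathbf{y}_j(t)\|=0\qquad\forall\,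 i,j\in[N].$$
   Context: Notation: $[N]=\{1,\dots,N\}$; $\|\cdot\|$ is the Euclidean norm and $\langle\cdot,\cdot\rangle$ the dot product on $\mathbb{R}^n$. Setting: robot $i$ has position $\mathbf{x}_i(t)\in\mathbb{R}^n$ with single-integrator kinematics $\dot{\mathbf{x}}_i=\mathbf{u}_i$, measures $\zeta_{ji}=\mathbf{x}_j-\mathbf{x}_i$ for its neighbors $j\in\mathcal{N}_i$, and uses the control $\mathbf{u}_i=k_p\sum_{j=1}^N w_{ij}(t)(\zeta_{ji}-\zeta_{ji}^* )$. Under realizability, $\zeta_{ji}-\zeta_{ji}^*=\mathbf{y}_j-\mathbf{y}_i$, which gives the stated equation for $\mathbf{y}_i$. The matrix $\mathbf{A}$ is fixed, with $a_{ij}>0$ exactly when robot $i$ uses the relative position of robot $j$, $a_{ii}=0$, and $\sum_j a_{ij}=1$. OExpGF algorithm: for $i\in[N]$, $w_{ij}(t)=0$ if $j\notin\mathcal{N}_i$, and for $j\in\mathcal{N}_i$ $$w_{ij}(t)=(1-\epsilon)\frac{a_{ij}\hat w_{ij}(t)}{\sum_{j'\in\mathcal{N}_i}a_{ij'}\hat w_{ij'}(t)}+\epsilon\,a_{ij},\qquad \hat w_{ij}(t)=\exp(-\eta_w\, l_{ij}(t)),$$ $$l_{ij}(t)=\int_0^t\gamma^{\,t-t'}\,g_{ij}(t')\,dt',$$ (equivalently $\dot l_{ij}=(\log\gamma)\,l_{ij}+g_{ij}$, $l_{ij}(0)=0$, so $\hat w_{ij}(0)=1$), where $g_{ij}(t)$,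 denoted $\frac{\partial e_i(t)}{\partial w_{ij}}$ and associated with the neighborhood formation distortion error $e_i(t)=\frac12\sum_{j\in\mathcal{N}_i}\|\mathbf{x}_j-\mathbf{x}_i-\zeta_{ji}^*\|^2$, is by definition $$g_{ij}(t)=\Big\langle -\sum_{j'\in\mathcal{N}_i}(\zeta_{j'i}(t)-\zeta_{j'i}^* ),\ \int_0^t k_p\,(\zeta_{ji}(t')-\zeta_{ji}^* )\,dt'\Big\rangle .$$ Thus $\mathbf{y}$ and the weights evolve jointly as a closed-loop system. *)

theory Defs
  imports "HOL-Analysis.Analysis"
begin

text \<open>
  Robots are indexed by a finite type \<open>'r\<close>, positions live in \<open>real^'n\<close>, and the stacked state of
  all robots at time \<open>t\<close> is \<open>x t :: real^'n^'r\<close>. A relative displacement with indices \<open>j i\<close> points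
  from robot \<open>i\<close> to robot \<open>j\<close>; for weights, gradients and losses the indices are \<open>i j\<close>, the updating
  robot first.
\<close>

definition row_stochastic :: "real^'r^'r \<Rightarrow> bool" where
  "row_stochastic A \<longleftrightarrow> (\<forall>i j. 0 \<le> A $ i $ j) \<and> (\<forall>i. (\<Sum>j\<in>UNIV. A $ i $ j) = 1)"

definition nbrs :: "real^'r^'r \<Rightarrow> 'r \<Rightarrow> 'r set" where
  "nbrs A i = {j. A $ i $ j > 0}"

text \<open>Edges follow the flow of information: \<open>j\<close> to \<open>i\<close> when robot \<open>i\<close> measures robot \<open>j\<close>.\<close>

definition info_flow :: "real^'r^'r \<Rightarrow> ('r \<times> 'r) set" where
  "info_flow A = {(j, i). A $ i $ j > 0}"

definition has_rooted_spanning_tree :: "real^'r^'r \<Rightarrow> bool" where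
  "has_rooted_spanning_tree A \<longleftrightarrow> (\<exists>k. \<forall>i. (k, i) \<in> (info_flow A)\<^sup>*)"

definition displacement :: "(real \<Rightarrow> real^'n^'r) \<Rightarrow> 'r \<Rightarrow> 'r \<Rightarrow> real \<Rightarrow> real^'n" where
  "displacement x j i t = x t $ j - x t $ i"

definition realizes :: "real^'r^'r \<Rightarrow> real^'n^'r \<Rightarrow> ('r \<Rightarrow> 'r \<Rightarrow> real^'n) \<Rightarrow> bool" where
  "realizes A xstar zstar \<longleftrightarrow> (\<forall>i. \<forall>j\<in>nbrs A i. zstar j i = xstar $ j - xstar $ i)"

text \<open>
  The quantity used by the algorithm as the gradient of the distortion error of robot \<open>i\<close> with
  respect to its weight for \<open>j\<close>. It is defined by this formula, not as an actual partial derivative.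
\<close>

definition grad ::
    "real^'r^'r \<Rightarrow> real \<Rightarrow> ('r \<Rightarrow> 'r \<Rightarrow> real^'n) \<Rightarrow> (real \<Rightarrow> real^'n^'r) \<Rightarrow> 'r \<Rightarrow> 'r \<Rightarrow> real \<Rightarrow> real" where
  "grad A kp zstar x i j t =
     (- (\<Sum>j'\<in>nbrs A i. displacement x j' i t - zstar j' i)) \<bullet>
     integral {0..t} (\<lambda>s. kp *\<^sub>R (displacement x j i s - zstar j i))"

definition discounted_loss ::
    "real^'r^'r \<Rightarrow> real \<Rightarrow> real \<Rightarrow> ('r \<Rightarrow> 'r \<Rightarrow> real^'n) \<Rightarrow> (real \<Rightarrow> real^'n^'r) \<Rightarrow>
     'r \<Rightarrow> 'r \<Rightarrow> real \<Rightarrow> real" where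
  "discounted_loss A kp \<gamma> zstar x i j t =
     integral {0..t} (\<lambda>s. \<gamma> powr (t - s) * grad A kp zstar x i j s)"

definition exp_weight ::
    "real^'r^'r \<Rightarrow> real \<Rightarrow> real \<Rightarrow> real \<Rightarrow> ('r \<Rightarrow> 'r \<Rightarrow> real^'n) \<Rightarrow> (real \<Rightarrow> real^'n^'r) \<Rightarrow>
     'r \<Rightarrow> 'r \<Rightarrow> real \<Rightarrow> real" where
  "exp_weight A kp \<eta> \<gamma> zstar x i j t = exp (- \<eta> * discounted_loss A kp \<gamma> zstar x i j t)"

definition oexpgf_weight ::
    "real^'r^'r \<Rightarrow> real \<Rightarrow> real \<Rightarrow> real \<Rightarrow> real \<Rightarrow> ('r \<Rightarrow> 'r \<Rightarrow> real^'n) \<Rightarrow> (real \<Rightarrow> real^'n^'r) \<Rightarrow>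
     'r \<Rightarrow> 'r \<Rightarrow> real \<Rightarrow> real" where
  "oexpgf_weight A kp \<eta> \<gamma> \<epsilon> zstar x i j t =
     (if j \<in> nbrs A i
      then (1 - \<epsilon>) * (A $ i $ j * exp_weight A kp \<eta> \<gamma> zstar x i j t /
              (\<Sum>j'\<in>nbrs A i. A $ i $ j' * exp_weight A kp \<eta> \<gamma> zstar x i j' t))
           + \<epsilon> * A $ i $ j
      else 0)"

end

theory Submission
  imports Defs
begin

text \<open>
  The rows of the weight matrix always sum to one and its entries stay above those of
  \<open>\<epsilon> A\<close>, whatever the losses are; this is all that is used of the algorithm. Each coordinate
  then solves \<open>z\<^sub>i' = \<kappa> (\<Sum>\<^sub>j W\<^sub>i\<^sub>j z\<^sub>j - z\<^sub>i)\<close>, so a lower bound \<open>p\<close> on the weighted averages makes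
  \<open>exp (\<kappa> t) (z\<^sub>i - p)\<close> nondecreasing. Hence the minimum over the robots never decreases, and the
  distance of the root from it spreads along the edges: after a fixed time every robot lies above
  the old minimum by a fixed fraction \<open>c\<close> of that distance. Adding the same estimate for \<open>- z\<close>
  shows that the spread shrinks by the factor \<open>1 - c\<close> over each such period.
\<close>

section \<open>Scalar averaging flows with time-varying row-stochastic weights\<close>

locale averaging_flow =
  fixes W :: "real \<Rightarrow> 'r::finite \<Rightarrow> 'r \<Rightarrow> real"
    and L :: "'r \<Rightarrow> 'r \<Rightarrow> real"
    and \<kappa> :: real
  assumes rate_pos: "\<kappa> > 0"
    and L_nonneg: "0 \<le> L i j"
    and L_le_W: "0 \<le> t \<Longrightarrow> L i j \<le> W t i j"
    and W_row_sum: "0 \<le> t \<Longrightarrow> (\<Sum>j\<in>UNIV. W t i j) = 1"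
begin

text \<open>Unit row sums bring the consensus law for one coordinate into this form, whose linear
  decay term is what the factor \<open>exp (\<kappa> * t)\<close> absorbs.\<close>

definition solution :: "(real \<Rightarrow> 'r \<Rightarrow> real) \<Rightarrow> bool" where
  "solution z \<longleftrightarrow> (\<forall>t\<ge>0. \<forall>i. ((\<lambda>s. z s i) has_real_derivative
     \<kappa> * ((\<Sum>j\<in>UNIV. W t i j * z t j) - z t i)) (at t within {0..}))"

lemma W_nonneg: "0 \<le> t \<Longrightarrow> 0 \<le> W t i j"
  using L_le_W L_nonneg order_trans by blast

text \<open>Every term \<open>W t i l * (v l - p)\<close> is nonnegative, so any single one bounds
  their sum from below. Dropping it keeps averages above \<open>p\<close>; keeping it measures the
  pull of robot \<open>j\<close>.\<close>

lemma average_ge: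
  assumes "0 \<le> t" "\<And>j. p \<le> v j"
  shows "p + W t i j * (v j - p) \<le> (\<Sum>l\<in>UNIV. W t i l * v l)"
proof -
  have "W t i j * (v j - p) \<le> (\<Sum>l\<in>UNIV. W t i l * (v l - p))"
    by (rule member_le_sum) (use assms W_nonneg in auto)
  also have "\<dots> = (\<Sum>l\<in>UNIV. W t i l * v l) - (\<Sum>l\<in>UNIV. W t i l) * p"
    by (simp add: right_diff_distrib sum_subtractf sum_distrib_right)
  finally show ?thesis
    using W_row_sum assms(1) by simp
qed

lemma solution_uminus:
  assumes "solution z"
  shows "solution (\<lambda>t i. - z t i)"
  unfolding solution_def
proof (intro allI impI)
  fix t :: real and i assume "0 \<le> t"
  then have "((\<lambda>s. z s i) has_real_derivative
      \<kappa> * ((\<Sum>j\<in>UNIV. W t i j * z t j) - z t i)) (at t within {0..})"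
    using assms by (simp add: solution_def)
  from DERIV_minus[OF this]
  show "((\<lambda>s. - z s i) has_real_derivative
      \<kappa> * ((\<Sum>j\<in>UNIV. W t i j * - z t j) - - z t i)) (at t within {0..})"
    by (simp add: sum_negf algebra_simps)
qed

lemma solution_continuous_on:
  assumes "solution z" "0 \<le> s"
  shows "continuous_on {s..t} (\<lambda>u. z u i)"
proof (rule continuous_on_subset)
  show "continuous_on {0..} (\<lambda>u. z u i)"
    using assms(1) unfolding solution_def continuous_on_eq_continuous_within
    by (auto intro!: DERIV_continuous)
qed (use assms in auto)

text \<open>The starting gap may be negative; the estimate then says that the deficit below
  \<open>p\<close> decays exponentially. Bounding the averages at interior times suffices: the
  derivative is two-sided there, and continuity reaches the end points.\<close>

lemma lower_barrier:
  assumes sol: "solution z" and st: "0 \<le> s" "s \<le> t"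
    and p: "\<And>u. s < u \<Longrightarrow> u < t \<Longrightarrow> p \<le> (\<Sum>j\<in>UNIV. W u i j * z u j)"
  shows "exp (- \<kappa> * (t - s)) * (z s i - p) \<le> z t i - p"
proof -
  have "exp (\<kappa> * s) * (z s i - p) \<le> exp (\<kappa> * t) * (z t i - p)"
  proof (rule DERIV_nonneg_imp_increasing_open[OF st(2)])
    fix u assume u: "s < u" "u < t"
    have "((\<lambda>v. z v i) has_real_derivative
        \<kappa> * ((\<Sum>j\<in>UNIV. W u i j * z u j) - z u i)) (at u within {0..})"
      using sol u st by (simp add: solution_def)
    moreover have "at u within {0..} = at u"
      using u st by (intro at_within_interior) simp
    ultimately have D: "((\<lambda>v. z v i) has_real_derivative
        \<kappa> * ((\<Sum>j\<in>UNIV. W u i j * z u j) - z u i)) (at u)"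
      by simp
    have "((\<lambda>v. exp (\<kappa> * v) * (z v i - p)) has_real_derivative
        \<kappa> * exp (\<kappa> * u) * ((\<Sum>j\<in>UNIV. W u i j * z u j) - p)) (at u)"
      by (auto intro!: derivative_eq_intros D simp: algebra_simps)
    moreover have "0 \<le> \<kappa> * exp (\<kappa> * u) * ((\<Sum>j\<in>UNIV. W u i j * z u j) - p)"
      using rate_pos p[OF u] by simp
    ultimately show "\<exists>d. ((\<lambda>v. exp (\<kappa> * v) * (z v i - p)) has_real_derivative d) (at u) \<and> 0 \<le> d"
      by blast
  qed (intro continuous_intros solution_continuous_on sol st)
  then have "exp (\<kappa> * s) / exp (\<kappa> * t) * (z s i - p) \<le> z t i - p"
    by (simp add: pos_divide_le_eq mult.commute)
  moreover have "exp (\<kappa> * s) / exp (\<kappa> * t) = exp (- \<kappa> * (t - s))"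
    by (simp add: exp_diff[symmetric] algebra_simps)
  ultimately show ?thesis
    by simp
qed

text \<open>Taking \<open>m\<close> itself as barrier would be circular, so the barrier is the
  minimum \<open>q\<close> over all robots and all times in \<open>{s..t}\<close>, below which no
  average can fall. Where \<open>q\<close> is attained the barrier estimate has right-hand side
  zero, so robot \<open>k\<close> started at or below \<open>q\<close>, whence
  \<open>m \<le> q\<close>.\<close>

lemma lower_bound_invariant:
  assumes sol: "solution z" and st: "0 \<le> s" "s \<le> t" and m: "\<And>i. m \<le> z s i"
  shows "m \<le> z t i"
proof -
  have "\<exists>u\<in>{s..t}. \<forall>v\<in>{s..t}. z u j \<le> z v j" for j
    by (rule continuous_attains_inf) (use st solution_continuous_on[OF sol] in auto)
  then obtain U where U: "\<And>j. U j \<in> {s..t}" "\<And>j v. v \<in> {s..t} \<Longrightarrow> z (U j) j \<le> z v j"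
    by metis
  define q where "q = Min (range (\<lambda>j. z (U j) j))"
  have "q \<in> range (\<lambda>j. z (U j) j)"
    unfolding q_def by (rule Min_in) auto
  then obtain k where k: "q = z (U k) k"
    by auto
  have q: "q \<le> z v j" if "v \<in> {s..t}" for v j
  proof -
    have "q \<le> z (U j) j"
      unfolding q_def by (rule Min_le) auto
    then show ?thesis
      using U(2)[OF that, of j] by simp
  qed
  have "exp (- \<kappa> * (U k - s)) * (z s k - q) \<le> z (U k) k - q"
  proof (rule lower_barrier[OF sol st(1)])
    fix u assume u: "s < u" "u < U k"
    then have u': "u \<in> {s..t}"
      using U(1)[of k] by auto
    then have "q \<le> z u j" for j
      by (rule q)
    moreover have "0 \<le> u"
      using u st by simp
    ultimately show "q \<le> (\<Sum>j\<in>UNIV. W u k j * z u j)"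
      using average_ge[of u q "z u" k k] W_nonneg[of u k k]
      by (smt (verit) mult_nonneg_nonneg)
  qed (use U(1)[of k] in auto)
  then have "z s k \<le> q"
    using k by (simp add: mult_le_0_iff)
  then show ?thesis
    using m[of k] q[of t i] st by simp
qed

text \<open>Induction along a path from the root, with \<open>c\<close> uniform in the solution and
  the starting time. The bound covers a whole time window because robot \<open>j\<close> must stay
  raised long enough to lift \<open>i\<close>; \<open>T\<close> comes after \<open>\<tau>\<close> so
  that one horizon can later serve all robots.\<close>

lemma root_influence:
  assumes "(k, i) \<in> {(j, i). L i j > 0}\<^sup>*"
  shows "\<exists>\<tau>\<ge>0. \<forall>T. \<exists>c>0. \<forall>z s m t. solution z \<longrightarrow> 0 \<le> s \<longrightarrow> (\<forall>j. m \<le> z s j) \<longrightarrow>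
           s + \<tau> \<le> t \<longrightarrow> t \<le> s + T \<longrightarrow> m + c * (z s k - m) \<le> z t i"
  using assms
proof (induction rule: rtrancl_induct)
  case base
  \<comment> \<open>The root's own gap decays at rate at most \<open>\<kappa>\<close>, and at most
    time \<open>T\<close> elapses.\<close>
  have "m + exp (- \<kappa> * T) * (z s k - m) \<le> z t k"
    if H: "solution z" "0 \<le> s" "\<forall>j. m \<le> z s j" "s + 0 \<le> t" "t \<le> s + T" for T z s m t
  proof -
    have "exp (- \<kappa> * (t - s)) * (z s k - m) \<le> z t k - m"
    proof (rule lower_barrier)
      fix u assume u: "s < u" "u < t"
      have "m \<le> z u j" for j
        using lower_bound_invariant[of z s u m j] H u by simp
      then show "m \<le> (\<Sum>j\<in>UNIV. W u k j * z u j)"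
        using average_ge[of u m "z u" k k] W_nonneg[of u k k] u H
        by (smt (verit) mult_nonneg_nonneg)
    qed (use H in auto)
    moreover have "exp (- \<kappa> * T) * (z s k - m) \<le> exp (- \<kappa> * (t - s)) * (z s k - m)"
      using H rate_pos by (intro mult_right_mono) auto
    ultimately show ?thesis
      by simp
  qed
  then show ?case
    by (intro exI[of _ 0] conjI allI exI[of _ "exp (- \<kappa> * T)" for T] impI) auto
next
  case (step j i)
  then obtain \<tau> where \<tau>: "\<tau> \<ge> 0" "\<And>T. \<exists>c>0. \<forall>z s m t. solution z \<longrightarrow> 0 \<le> s \<longrightarrow>
      (\<forall>j. m \<le> z s j) \<longrightarrow> s + \<tau> \<le> t \<longrightarrow> t \<le> s + T \<longrightarrow> m + c * (z s k - m) \<le> z t j"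
    by blast
  have Lij: "L i j > 0"
    using step by simp
  have "\<exists>c>0. \<forall>z s m t. solution z \<longrightarrow> 0 \<le> s \<longrightarrow> (\<forall>j. m \<le> z s j) \<longrightarrow>
      s + (\<tau> + 1) \<le> t \<longrightarrow> t \<le> s + T \<longrightarrow> m + c * (z s k - m) \<le> z t i" for T
  proof -
    obtain c where c: "c > 0" "\<And>z s m t. solution z \<Longrightarrow> 0 \<le> s \<Longrightarrow> (\<forall>j. m \<le> z s j) \<Longrightarrow>
        s + \<tau> \<le> t \<Longrightarrow> t \<le> s + T \<Longrightarrow> m + c * (z s k - m) \<le> z t j"
      using \<tau>(2)[of T] by blast
    have "m + (1 - exp (- \<kappa>)) * L i j * c * (z s k - m) \<le> z t i"
      if H: "solution z" "0 \<le> s" "\<forall>j. m \<le> z s j" "s + (\<tau> + 1) \<le> t" "t \<le> s + T" for z s m t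
    proof -
      \<comment> \<open>From time \<open>s + \<tau>\<close> on, robot \<open>j\<close> keeps the
        averages of \<open>i\<close> above \<open>m + d\<close>. The initial deficit of
        \<open>i\<close>, at most \<open>d\<close>, shrinks by at least the factor
        \<open>exp (- \<kappa>)\<close> during the extra unit of time, which leaves the gain
        \<open>(1 - exp (- \<kappa>)) * d\<close>.\<close>
      define d where "d = L i j * (c * (z s k - m))"
      have d: "0 \<le> d"
        unfolding d_def using Lij c H by simp
      have inv: "m \<le> z u l" if "s \<le> u" for u l
        using lower_bound_invariant[of z s u m l] H that by simp
      have "exp (- \<kappa> * (t - (s + \<tau>))) * (z (s + \<tau>) i - (m + d)) \<le> z t i - (m + d)"
      proof (rule lower_barrier)
        fix u assume u: "s + \<tau> < u" "u < t"
        have u0: "0 \<le> u" "s \<le> u"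
          using u H \<tau> by auto
        have "c * (z s k - m) \<le> z u j - m"
          using c(2)[of z s m u] H u by simp
        then have "d \<le> W u i j * (z u j - m)"
          unfolding d_def using L_le_W[of u i j] Lij u0 c H by (intro mult_mono) auto
        then show "m + d \<le> (\<Sum>l\<in>UNIV. W u i l * z u l)"
          using average_ge[of u m "z u" i j] u0 inv by fastforce
      qed (use H \<tau> in auto)
      moreover have "exp (- \<kappa> * (t - (s + \<tau>))) * (- d)
          \<le> exp (- \<kappa> * (t - (s + \<tau>))) * (z (s + \<tau>) i - (m + d))"
        using inv[of "s + \<tau>" i] \<tau> by (intro mult_left_mono) auto
      moreover have "exp (- \<kappa>) * (- d) \<le> exp (- \<kappa> * (t - (s + \<tau>))) * (- d)"
        using d H rate_pos by (intro mult_right_mono_neg) auto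
      ultimately have "exp (- \<kappa>) * (- d) \<le> z t i - (m + d)"
        by (meson order_trans)
      then have "m + (1 - exp (- \<kappa>)) * d \<le> z t i"
        by (simp add: algebra_simps)
      then show ?thesis
        by (simp add: d_def mult.assoc)
    qed
    moreover have "(1 - exp (- \<kappa>)) * L i j * c > 0"
      using rate_pos Lij c by simp
    ultimately show ?thesis
      by blast
  qed
  then show ?case
    using \<tau>(1) by (intro exI[of _ "\<tau> + 1"]) simp
qed

text \<open>Finitely many robots allow a largest delay and a smallest fraction. The inserted
  \<open>1\<close> and \<open>1/2\<close> make \<open>T\<close> positive and keep the fraction below
  one.\<close>

lemma uniform_root_influence:
  assumes root: "\<And>i. (k, i) \<in> {(j, i). L i j > 0}\<^sup>*"
  obtains T c where "T > 0" "0 < c" "c < 1"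
    "\<And>z s m i. \<lbrakk>solution z; 0 \<le> s; \<And>j. m \<le> z s j\<rbrakk> \<Longrightarrow> m + c * (z s k - m) \<le> z (s + T) i"
proof -
  obtain \<tau> where \<tau>: "\<And>i T. \<exists>c>0. \<forall>z s m t. solution z \<longrightarrow> 0 \<le> s \<longrightarrow>
      (\<forall>j. m \<le> z s j) \<longrightarrow> s + \<tau> i \<le> t \<longrightarrow> t \<le> s + T \<longrightarrow> m + c * (z s k - m) \<le> z t i"
    using root_influence[OF root] by metis
  define T where "T = Max (insert 1 (range \<tau>))"
  have T: "1 \<le> T" "\<tau> i \<le> T" for i
    unfolding T_def by (rule Max_ge; simp)+
  obtain c where c: "\<And>i. c i > 0" "\<And>i z s m t. solution z \<Longrightarrow> 0 \<le> s \<Longrightarrow>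
      (\<forall>j. m \<le> z s j) \<Longrightarrow> s + \<tau> i \<le> t \<Longrightarrow> t \<le> s + T \<Longrightarrow> m + c i * (z s k - m) \<le> z t i"
    using \<tau>[of _ T] by metis
  define d where "d = Min (insert (1/2) (range c))"
  have d: "d \<le> 1/2" "d \<le> c i" for i
    unfolding d_def by (rule Min_le; simp)+
  have "d > 0"
    unfolding d_def using c(1) by (subst Min_gr_iff) auto
  moreover have "m + d * (z s k - m) \<le> z (s + T) i"
    if H: "solution z" "0 \<le> s" "\<And>j. m \<le> z s j" for z s m i
  proof -
    have "d * (z s k - m) \<le> c i * (z s k - m)"
      using d H by (intro mult_right_mono) auto
    then show ?thesis
      using c(2)[of z s m i "s + T"] H T(2)[of i] by fastforce
  qed
  ultimately show ?thesis
    using T d by (intro that[of T d]) auto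
qed

section \<open>Geometric contraction of the spread\<close>

theorem consensus:
  assumes root: "\<And>i. (k, i) \<in> {(j, i). L i j > 0}\<^sup>*" and sol: "solution z"
  shows "((\<lambda>t. z t i - z t j) \<longlongrightarrow> 0) at_top"
proof -
  obtain T c where T: "T > 0" and c: "0 < c" "c < 1"
    and infl: "\<And>z s m i. \<lbrakk>solution z; 0 \<le> s; \<And>j. m \<le> z s j\<rbrakk> \<Longrightarrow>
      m + c * (z s k - m) \<le> z (s + T) i"
    using uniform_root_influence[OF root] by metis
  define spread where "spread n = (1 - c) ^ n * (Max (range (z 0)) - Min (range (z 0)))" for n
  \<comment> \<open>\<open>m\<close> and \<open>M\<close> may differ from the exact extremes at time
    \<open>n * T\<close>: bounds with a prescribed gap pass directly to the next period.\<close>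
  have bounds: "\<exists>m M. M - m = spread n \<and> (\<forall>i. m \<le> z (n * T) i \<and> z (n * T) i \<le> M)" for n :: nat
  proof (induction n)
    case 0
    show ?case
      by (intro exI[of _ "Min (range (z 0))"] exI[of _ "Max (range (z 0))"])
        (auto simp: spread_def)
  next
    case (Suc n)
    then obtain m M where mM: "M - m = spread n" "\<And>i. m \<le> z (n * T) i" "\<And>i. z (n * T) i \<le> M"
      by blast
    let ?r = "z (n * T) k"
    have next_time: "n * T + T = Suc n * T"
      by (simp add: algebra_simps)
    have "m + c * (?r - m) \<le> z (n * T + T) i" for i
      using infl[OF sol, of "n * T" m i] mM T by simp
    moreover have "z (n * T + T) i \<le> M - c * (M - ?r)" for i
      using infl[OF solution_uminus[OF sol], of "n * T" "- M" i] mM T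
      by (simp add: algebra_simps)
    \<comment> \<open>The root's value \<open>?r\<close> cancels: what the lower bound misses when
      the root sits low, the upper bound gains.\<close>
    moreover have "(M - c * (M - ?r)) - (m + c * (?r - m)) = spread (Suc n)"
    proof -
      have "spread (Suc n) = (1 - c) * (M - m)"
        using mM(1) by (simp add: spread_def)
      then show ?thesis
        by (simp add: algebra_simps)
    qed
    ultimately show ?case
      unfolding next_time by blast
  qed
  \<comment> \<open>Invariance of both bounds carries the estimate from the sampling times to all
    later times.\<close>
  have later: "\<bar>z t i - z t j\<bar> \<le> spread n" if "n * T \<le> t" for n :: nat and t
  proof -
    obtain m M where mM: "M - m = spread n" "\<And>i. m \<le> z (n * T) i" "\<And>i. z (n * T) i \<le> M"
      using bounds[of n] by blast
    have "m \<le> z t i" "z t i \<le> M" for i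
      using lower_bound_invariant[OF sol, of "n * T" t m i] mM that T
        lower_bound_invariant[OF solution_uminus[OF sol], of "n * T" t "- M" i] by auto
    from this[of i] this[of j] show ?thesis
      using mM(1) by linarith
  qed
  have lim: "spread \<longlonglongrightarrow> 0"
    unfolding spread_def by (rule tendsto_mult_left_zero) (use c in \<open>intro LIMSEQ_realpow_zero; simp\<close>)
  show ?thesis
  proof (rule tendstoI)
    fix e :: real assume "0 < e"
    then obtain n where "spread n < e"
      using order_tendstoD(2)[OF lim] eventually_happens' sequentially_bot by blast
    then have "dist (z t i - z t j) 0 < e" if "n * T \<le> t" for t
      using later[OF that] by simp
    then show "\<forall>\<^sub>F t in at_top. dist (z t i - z t j) 0 < e"
      unfolding eventually_at_top_linorder by blast
  qed
qed

end

section \<open>Lower bounds and row sums of the OExpGF weights\<close>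

lemma oexpgf_weight_ge:
  assumes "row_stochastic A" "0 \<le> \<epsilon>" "\<epsilon> \<le> 1"
  shows "\<epsilon> * A $ i $ j \<le> oexpgf_weight A kp \<eta> \<gamma> \<epsilon> zstar x i j t"
proof (cases "j \<in> nbrs A i")
  \<comment> \<open>Exponentials are positive whatever value the loss has, so the normalised part is
    nonnegative and \<open>\<epsilon> * A $ i $ j\<close> remains.\<close>
  case True
  then show ?thesis
    using assms unfolding oexpgf_weight_def row_stochastic_def
    by (auto intro!: mult_nonneg_nonneg divide_nonneg_nonneg sum_nonneg simp: exp_weight_def)
next
  case False
  then have "A $ i $ j = 0"
    using assms by (force simp: nbrs_def row_stochastic_def not_less intro: antisym)
  then show ?thesis
    by (simp add: oexpgf_weight_def nbrs_def)
qed

lemma oexpgf_weight_row_sum: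
  assumes "row_stochastic A"
  shows "(\<Sum>j\<in>UNIV. oexpgf_weight A kp \<eta> \<gamma> \<epsilon> zstar x i j t) = 1"
proof -
  have "(\<Sum>j\<in>nbrs A i. A $ i $ j) = (\<Sum>j\<in>UNIV. A $ i $ j)"
    by (rule sum.mono_neutral_left)
      (use assms in \<open>force simp: nbrs_def row_stochastic_def not_less intro: antisym\<close>)+
  then have A_sum: "(\<Sum>j\<in>nbrs A i. A $ i $ j) = 1"
    using assms by (simp add: row_stochastic_def)
  \<comment> \<open>A row sum of one forces a positive entry, so the normalising denominator is a
    nonempty sum of positive terms.\<close>
  then have "nbrs A i \<noteq> {}"
    by force
  let ?v = "\<lambda>j. A $ i $ j * exp_weight A kp \<eta> \<gamma> zstar x i j t"
  have S: "sum ?v (nbrs A i) > 0"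
    by (rule sum_pos) (use \<open>nbrs A i \<noteq> {}\<close> in \<open>auto simp: nbrs_def exp_weight_def\<close>)
  have "(\<Sum>j\<in>UNIV. oexpgf_weight A kp \<eta> \<gamma> \<epsilon> zstar x i j t)
      = (\<Sum>j\<in>nbrs A i. (1 - \<epsilon>) * (?v j / sum ?v (nbrs A i)) + \<epsilon> * A $ i $ j)"
    by (rule sum.mono_neutral_cong_right) (auto simp: oexpgf_weight_def)
  also have "\<dots> = (1 - \<epsilon>) * (sum ?v (nbrs A i) / sum ?v (nbrs A i))
      + \<epsilon> * (\<Sum>j\<in>nbrs A i. A $ i $ j)"
    by (simp add: sum.distrib flip: sum_distrib_left sum_divide_distrib)
  finally show ?thesis
    using S A_sum by simp
qed

section \<open>Reduction of the closed loop to scalar averaging flows\<close>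

theorem theorem1:
  fixes A :: "real^'r^'r"
    and zstar :: "'r \<Rightarrow> 'r \<Rightarrow> real^'n"
    and xstar :: "real^'n^'r"
    and x y :: "real \<Rightarrow> real^'n^'r"
    and kp \<eta> \<gamma> \<epsilon> :: real
  assumes "CARD('r) \<ge> 2"
    and "row_stochastic A"
    and "\<And>i. A $ i $ i = 0"
    and "realizes A xstar zstar"
    and "has_rooted_spanning_tree A"
    and "kp > 0" and "\<eta> > 0" and "0 < \<gamma>" and "\<gamma> \<le> 1" and "0 < \<epsilon>" and "\<epsilon> < 1"
    and "\<And>t i. t \<ge> 0 \<Longrightarrow> y t $ i = x t $ i - xstar $ i"
    and "\<And>t i. t \<ge> 0 \<Longrightarrow>
           ((\<lambda>s. y s $ i) has_vector_derivative
              kp *\<^sub>R (\<Sum>j\<in>UNIV. oexpgf_weight A kp \<eta> \<gamma> \<epsilon> zstar x i j t *\<^sub>R (y t $ j - y t $ i)))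
           (at t within {0..})"
  shows "\<forall>i j. ((\<lambda>t. norm (y t $ i - y t $ j)) \<longlongrightarrow> 0) at_top"
proof -
  let ?W = "\<lambda>t i j. oexpgf_weight A kp \<eta> \<gamma> \<epsilon> zstar x i j t"
  let ?L = "\<lambda>i j. \<epsilon> * A $ i $ j"
  \<comment> \<open>Along the given trajectory the weights are just functions of time, so the closed
    loop can be read as a linear time-varying flow.\<close>
  interpret averaging_flow ?W ?L kp
  proof
    show "?L i j \<le> ?W t i j" for t i j
      using assms by (intro oexpgf_weight_ge) auto
    show "(\<Sum>j\<in>UNIV. ?W t i j) = 1" for t i
      using assms(2) by (rule oexpgf_weight_row_sum)
  qed (use assms in \<open>auto simp: row_stochastic_def\<close>)
  have sol: "solution (\<lambda>t i. y t $ i $ c)" for c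
    unfolding solution_def
  proof (intro allI impI)
    fix t :: real and i assume t: "0 \<le> t"
    have "(\<Sum>j\<in>UNIV. ?W t i j * (y t $ j $ c - y t $ i $ c))
        = (\<Sum>j\<in>UNIV. ?W t i j * y t $ j $ c) - (\<Sum>j\<in>UNIV. ?W t i j) * y t $ i $ c"
      by (simp add: right_diff_distrib sum_subtractf sum_distrib_right)
    then show "((\<lambda>s. y s $ i $ c) has_real_derivative
        kp * ((\<Sum>j\<in>UNIV. ?W t i j * y t $ j $ c) - y t $ i $ c)) (at t within {0..})"
      using bounded_linear.has_vector_derivative[OF bounded_linear_vec_nth assms(13)[OF t, of i], of c]
        W_row_sum[OF t, of i]
      by (simp add: has_real_derivative_iff_has_vector_derivative)
  qed
  \<comment> \<open>As \<open>\<epsilon>\<close> is positive, the constant bounds \<open>?L\<close>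
    carry exactly the edges of the information graph.\<close>
  have "{(j, i). ?L i j > 0} = info_flow A"
    using assms by (auto simp: info_flow_def zero_less_mult_iff)
  then obtain k where root: "\<And>i. (k, i) \<in> {(j, i). ?L i j > 0}\<^sup>*"
    using assms by (auto simp: has_rooted_spanning_tree_def)
  have "((\<lambda>t. y t $ i - y t $ j) \<longlongrightarrow> 0) at_top" for i j
    using consensus[OF root sol, where i = i and j = j] by (intro vec_tendstoI) simp
  then show ?thesis
    by (simp add: tendsto_norm_zero)
qed

end
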